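(* Let $\mathbf{X}$, $\mathbf{Y}$ be computable metric spaces. The evaluation map $\textsc{Eval} : \Delta_2^0(\mathbf{X}, \mathbf{Y}) \times \mathbf{X} \to \mathbf{Y}$, $\textsc{Eval}(f,x)=f(x)$, satisfies $\textsc{Eval} \leq_\mathrm{W} C_{\mathbb{N}}$.
   Context: Work in computable analysis (Type-2 theory of effectivity). A represented space is a set $X$ with a partial surjection $\delta_X :\subseteq \{0,1\}^\mathbb{N} \to X$; names of $x$ are elements of $\delta_X^{-1}(x)$. A computable metric space is a separable metric space with a fixed dense sequence whose mutual distances are uniformly computable, with its standard Cauchy representation. For a represented space $\mathbf{X}$, $\mathcal{O}(\mathbf{X})$ is the space of open subsets and $\mathcal{A}(\mathbf{X})$ the space of closed subsets, with their standard representations (an open set is represented so that membership is semidecidable uniformly, e.g. for metric spaces by enumerating rational balls whose union it is; a closed set is represented by a name of its complement as an open set). $\mathcal{C}(\mathbf{X},\mathbf{Y})$ is the represented space of continuous functions, and $\mathcal{C}(\mathbb{N},\cdot)$ sequences. The space $\Delta_2^0(\mathbf{X})$: a sequence $(A_i, U_i)_{i \in \mathbb{N}} \in \mathcal{C}(\mathbb{N}, \mathcal{A}(\mathbf{X}) \times \mathcal{O}(\mathbf{X}))$ is a name of the set $D = \bigcup_i A_i = \bigcap_i U_i$ (it names nothing if these two sets differ). The space $\Delta_2^0(\mathbf{X}, \mathbf{Y})$ of $\Delta_2^0$-measurable functions is the subspace of $\mathcal{C}(\mathcal{O}(\mathbf{Y}), \Delta_2^0(\mathbf{X}))$ consisting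 of the maps of the form $U \mapsto f^{-1}(U)$ for some function $f : \mathbf{X} \to \mathbf{Y}$ (identified with $f$). Weihrauch reducibility: for multivalued $f :\subseteq \mathbf{X} \rightrightarrows \mathbf{Y}$, $g :\subseteq \mathbf{U} \rightrightarrows \mathbf{V}$, $f \leq_\mathrm{W} g$ iff there are computable $H, K :\subseteq \{0,1\}^\mathbb{N} \to \{0,1\}^\mathbb{N}$ such that for every realizer $G$ of $g$ (a function on names mapping any name of $u\in\operatorname{dom}(g)$ to a name of some element of $g(u)$), the map $x \mapsto H(\langle x, GK(x)\rangle)$ is a realizer of $f$. Closed choice on $\mathbb{N}$ is $C_\mathbb{N} :\subseteq \mathcal{A}(\mathbb{N}) \rightrightarrows \mathbb{N}$ with domain the nonempty closed sets and $C_\mathbb{N}(A) = A$ (i.e. output any element of $A$). *)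

theory Defs
  imports "HOL-Analysis.Analysis" "HOL-Library.Nat_Bijection"
begin

text \<open>
  Type-2 computability on Cantor space, represented spaces, computable metric spaces,
  \<open>\<Delta>\<^sup>0\<^sub>2\<close>-measurable functions and Weihrauch reducibility.
\<close>

type_synonym cantor = "nat \<Rightarrow> bool"

text \<open>The partial function whose graph is a (functional) relation.\<close>

definition partial_of :: "('a \<Rightarrow> 'b \<Rightarrow> bool) \<Rightarrow> 'a \<rightharpoonup> 'b" where
  "partial_of P x = (if \<exists>!y. P x y then Some (THE y. P x y) else None)"

lemma partial_of_eq_Some: "partial_of P x = Some y \<longleftrightarrow> P x y \<and> (\<forall>z. P x z \<longrightarrow> z = y)"
proof
  assume "partial_of P x = Some y"
  then have ex: "\<exists>!y. P x y" and y: "y = (THE y. P x y)"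
    unfolding partial_of_def by (auto split: if_splits)
  from theI'[OF ex] y have "P x y" by simp
  with ex show "P x y \<and> (\<forall>z. P x z \<longrightarrow> z = y)" by blast
next
  assume *: "P x y \<and> (\<forall>z. P x z \<longrightarrow> z = y)"
  then have ex: "\<exists>!y. P x y" by blast
  have "(THE y. P x y) = y" using * by (intro the_equality) simp_all
  with ex show "partial_of P x = Some y" by (simp add: partial_of_def)
qed

lemma partial_of_functional:
  assumes "\<And>y z. P x y \<Longrightarrow> P x z \<Longrightarrow> z = y"
  shows "partial_of P x = Some y \<longleftrightarrow> P x y"
  unfolding partial_of_eq_Some using assms by blast


subsection \<open>Computability\<close>

text \<open>
  Partial recursive functions relative to an oracle in Cantor space, uniformly in the oracle.
  Functions are unary; several arguments are passed through the pairing \<open>prod_encode\<close>, whose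
  projections and tupling are among the basic operations.
\<close>

inductive oracle_recursive :: "(cantor \<Rightarrow> nat \<rightharpoonup> nat) \<Rightarrow> bool" where
  zero: "oracle_recursive (\<lambda>p n. Some 0)"
| succ: "oracle_recursive (\<lambda>p n. Some (Suc n))"
| query: "oracle_recursive (\<lambda>p n. Some (of_bool (p n)))"
| left: "oracle_recursive (\<lambda>p n. Some (fst (prod_decode n)))"
| right: "oracle_recursive (\<lambda>p n. Some (snd (prod_decode n)))"
| pair: "oracle_recursive \<phi> \<Longrightarrow> oracle_recursive \<psi> \<Longrightarrow>
    oracle_recursive
      (\<lambda>p n. Option.bind (\<phi> p n) (\<lambda>u. Option.bind (\<psi> p n) (\<lambda>v. Some (prod_encode (u, v)))))"
| comp: "oracle_recursive \<phi> \<Longrightarrow> oracle_recursive \<psi> \<Longrightarrow>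
    oracle_recursive (\<lambda>p n. Option.bind (\<phi> p n) (\<psi> p))"
| prim_rec: "oracle_recursive \<phi> \<Longrightarrow> oracle_recursive \<psi> \<Longrightarrow>
    oracle_recursive
      (\<lambda>p n. case prod_decode n of (x, k) \<Rightarrow>
         rec_nat (\<phi> p x)
           (\<lambda>m r. Option.bind r (\<lambda>v. \<psi> p (prod_encode (x, prod_encode (m, v))))) k)"
| minimize: "oracle_recursive \<phi> \<Longrightarrow>
    oracle_recursive
      (\<lambda>p. partial_of (\<lambda>x n. \<phi> p (prod_encode (x, n)) = Some 0 \<and>
         (\<forall>m<n. \<exists>v. \<phi> p (prod_encode (x, m)) = Some (Suc v))))"

text \<open>Plain computability of a total function: a program whose result ignores the oracle.\<close>

definition computable_nat :: "(nat \<Rightarrow> nat) \<Rightarrow> bool" where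
  "computable_nat f \<longleftrightarrow> (\<exists>\<phi>. oracle_recursive \<phi> \<and> (\<forall>p n. \<phi> p n = Some (f n)))"

text \<open>
  \<open>F\<close> is computable if one program, with the input sequence as oracle, produces the
  output sequence bit by bit; nothing is required outside the domain of \<open>F\<close>.
\<close>

definition computable_cantor :: "(cantor \<rightharpoonup> cantor) \<Rightarrow> bool" where
  "computable_cantor F \<longleftrightarrow>
     (\<exists>\<phi>. oracle_recursive \<phi> \<and>
       (\<forall>p q. F p = Some q \<longrightarrow> (\<forall>n. \<phi> p n = Some (of_bool (q n)))))"


subsection \<open>Represented spaces\<close>

text \<open>
  A represented space is given by its representation \<open>\<delta>\<close>; the underlying set is \<open>ran \<delta>\<close>.
\<close>

type_synonym 'a rep = "cantor \<rightharpoonup> 'a"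

definition cpair :: "cantor \<Rightarrow> cantor \<Rightarrow> cantor" where
  "cpair p q n = (if even n then p (n div 2) else q (n div 2))"

definition cfst :: "cantor \<Rightarrow> cantor" where "cfst r n = r (2 * n)"

definition csnd :: "cantor \<Rightarrow> cantor" where "csnd r n = r (2 * n + 1)"

lemma cfst_cpair [simp]: "cfst (cpair p q) = p"
  and csnd_cpair [simp]: "csnd (cpair p q) = q"
  by (auto simp: cpair_def cfst_def csnd_def)

lemma cpair_collapse [simp]: "cpair (cfst r) (csnd r) = r"
  by (rule ext) (auto simp: cpair_def cfst_def csnd_def elim: oddE)

text \<open>The \<open>i\<close>-th component of \<open>p\<close>, seen as an infinite tuple of sequences.\<close>

definition component :: "cantor \<Rightarrow> nat \<Rightarrow> cantor" where
  "component p i n = p (prod_encode (i, n))"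

text \<open>The set of numbers enumerated by \<open>p\<close>: \<open>m\<close> appears at stage \<open>t\<close> if bit \<open>(t, m)\<close> is set.\<close>

definition enumerated :: "cantor \<Rightarrow> nat set" where
  "enumerated p = {m. \<exists>t. p (prod_encode (t, m))}"

definition prod_rep :: "'a rep \<Rightarrow> 'b rep \<Rightarrow> ('a \<times> 'b) rep" where
  "prod_rep \<delta> \<epsilon> r =
     Option.bind (\<delta> (cfst r)) (\<lambda>x. Option.bind (\<epsilon> (csnd r)) (\<lambda>y. Some (x, y)))"

text \<open>The names of \<open>n\<close> are the sequences starting with \<open>0\<^sup>n1\<close>.\<close>

definition nat_rep :: "nat rep" where
  "nat_rep p = (if \<exists>n. p n then Some (LEAST n. p n) else None)"

text \<open>
  Continuous partial functions on Cantor space are coded as in Kleene's associates: \<open>p\<close>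
  enumerates triples (finite word \<open>u\<close>, position \<open>n\<close>, bit \<open>b\<close>), meaning that bit \<open>n\<close> of the
  output is \<open>b\<close> on every input extending \<open>u\<close>. The function is defined at an input if the
  triples applicable to it determine each output bit without conflict.
\<close>

definition prefix_code :: "cantor \<Rightarrow> nat \<Rightarrow> nat" where
  "prefix_code q k = list_encode (map (\<lambda>i. of_bool (q i)) [0..<k])"

definition associate_apply :: "cantor \<Rightarrow> cantor \<rightharpoonup> cantor" where
  "associate_apply p =
     partial_of (\<lambda>q r. \<forall>n b.
       (\<exists>k. prod_encode (prefix_code q k, prod_encode (n, of_bool b)) \<in> enumerated p)
       \<longleftrightarrow> b = r n)"

text \<open>
  The space \<open>\<C>(X, Y)\<close>: names code continuous realizers. A function on the underlying set of
  \<open>X\<close> is modelled by its extensional version (\<open>undefined\<close> outside that set).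
\<close>

definition fun_rep :: "'a rep \<Rightarrow> 'b rep \<Rightarrow> ('a \<Rightarrow> 'b) rep" where
  "fun_rep \<delta> \<epsilon> =
     partial_of (\<lambda>p f. f \<in> extensional (ran \<delta>) \<and>
       (\<forall>q x. \<delta> q = Some x \<longrightarrow> (\<exists>r. associate_apply p q = Some r \<and> \<epsilon> r = Some (f x))))"


subsection \<open>Computable metric spaces\<close>

definition rat_of_code :: "nat \<Rightarrow> real" where
  "rat_of_code c = real (fst (prod_decode c)) / real (Suc (snd (prod_decode c)))"

definition computable_metric_space :: "(nat \<Rightarrow> 'a::metric_space) \<Rightarrow> bool" where
  "computable_metric_space a \<longleftrightarrow>
     closure (range a) = UNIV \<and>
     (\<exists>f. computable_nat f \<and>
       (\<forall>i j k. \<bar>dist (a i) (a j) - rat_of_code (f (prod_encode (prod_encode (i, j), k)))\<bar>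
                 \<le> (1/2) ^ k))"

definition cauchy_rep :: "(nat \<Rightarrow> 'a::metric_space) \<Rightarrow> 'a rep" where
  "cauchy_rep a =
     partial_of (\<lambda>p x. \<exists>s. (\<forall>i. nat_rep (component p i) = Some (s i)) \<and>
       (\<forall>i j. i < j \<longrightarrow> dist (a (s i)) (a (s j)) \<le> (1/2) ^ i) \<and>
       (\<lambda>i. a (s i)) \<longlonglongrightarrow> x)"

definition rational_ball :: "(nat \<Rightarrow> 'a::metric_space) \<Rightarrow> nat \<Rightarrow> 'a set" where
  "rational_ball a m = ball (a (fst (prod_decode m))) (rat_of_code (snd (prod_decode m)))"

definition open_rep :: "(nat \<Rightarrow> 'a::metric_space) \<Rightarrow> 'a set rep" where
  "open_rep a p = Some (\<Union>m\<in>enumerated p. rational_ball a m)"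

definition closed_rep :: "(nat \<Rightarrow> 'a::metric_space) \<Rightarrow> 'a set rep" where
  "closed_rep a p = map_option uminus (open_rep a p)"


subsection \<open>\<open>\<Delta>\<^sup>0\<^sub>2\<close> sets and \<open>\<Delta>\<^sup>0\<^sub>2\<close>-measurable functions\<close>

definition delta2_rep :: "(nat \<Rightarrow> 'a::metric_space) \<Rightarrow> 'a set rep" where
  "delta2_rep a =
     partial_of (\<lambda>p D. \<exists>S. fun_rep nat_rep (prod_rep (closed_rep a) (open_rep a)) p = Some S \<and>
       D = (\<Union>i. fst (S i)) \<and> D = (\<Inter>i. snd (S i)))"

definition delta2_fun_rep ::
  "(nat \<Rightarrow> 'a::metric_space) \<Rightarrow> (nat \<Rightarrow> 'b::metric_space) \<Rightarrow> ('a \<Rightarrow> 'b) rep" where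
  "delta2_fun_rep a b =
     partial_of (\<lambda>p f. fun_rep (open_rep b) (delta2_rep a) p
                         = Some (restrict (\<lambda>U. f -` U) {U. open U}))"


subsection \<open>Weihrauch reducibility\<close>

text \<open>
  A multivalued partial function between represented spaces; its domain consists of the
  points \<open>x\<close> of the input space with \<open>solutions x \<noteq> {}\<close>.
\<close>

record ('a, 'b) problem =
  inputs :: "'a rep"
  outputs :: "'b rep"
  solutions :: "'a \<Rightarrow> 'b set"

definition realizer :: "('a, 'b) problem \<Rightarrow> (cantor \<rightharpoonup> cantor) \<Rightarrow> bool" where
  "realizer f F \<longleftrightarrow>
     (\<forall>p x. inputs f p = Some x \<and> solutions f x \<noteq> {} \<longrightarrow>
       (\<exists>q y. F p = Some q \<and> outputs f q = Some y \<and> y \<in> solutions f x))"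

definition weihrauch_le :: "('a, 'b) problem \<Rightarrow> ('c, 'd) problem \<Rightarrow> bool" (infix "\<le>\<^sub>W" 50) where
  "f \<le>\<^sub>W g \<longleftrightarrow>
     (\<exists>H K. computable_cantor H \<and> computable_cantor K \<and>
       (\<forall>G. realizer g G \<longrightarrow>
         realizer f (\<lambda>p. Option.bind (K p) (\<lambda>k. Option.bind (G k) (\<lambda>r. H (cpair p r))))))"

definition eval_problem ::
  "(nat \<Rightarrow> 'a::metric_space) \<Rightarrow> (nat \<Rightarrow> 'b::metric_space) \<Rightarrow> (('a \<Rightarrow> 'b) \<times> 'a, 'b) problem" where
  "eval_problem a b =
     \<lparr>inputs = prod_rep (delta2_fun_rep a b) (cauchy_rep a), outputs = cauchy_rep b,
      solutions = (\<lambda>(f, x). {f x})\<rparr>"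

text \<open>
  \<open>\<nat>\<close> is discrete, so a name of a closed subset is an enumeration of its complement.
\<close>

definition closed_nat_rep :: "nat set rep" where
  "closed_nat_rep p = Some (- enumerated p)"

definition closed_choice_nat :: "(nat set, nat) problem" where
  "closed_choice_nat =
     \<lparr>inputs = closed_nat_rep, outputs = nat_rep, solutions = (\<lambda>A. A)\<rparr>"


subsection \<open>The representations are onto and names determine their points\<close>

lemma ran_nat_rep: "ran nat_rep = UNIV"
proof -
  have "nat_rep (\<lambda>i. i = n) = Some n" for n
    by (simp add: nat_rep_def Least_equality)
  then show ?thesis by (auto simp: ran_def)
qed

lemma associate_apply_eq_Some:
  "associate_apply p q = Some r \<longleftrightarrow>
     (\<forall>n b. (\<exists>k. prod_encode (prefix_code q k, prod_encode (n, of_bool b)) \<in> enumerated p)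
        \<longleftrightarrow> b = r n)"
    (is "_ \<longleftrightarrow> ?P r")
proof -
  have u: "s = r" if "?P r" "?P s" for r s
  proof
    fix n show "s n = r n" using that by blast
  qed
  show ?thesis
    unfolding associate_apply_def by (rule partial_of_functional) (rule u)
qed

lemma fun_rep_eq_Some:
  "fun_rep \<delta> \<epsilon> p = Some f \<longleftrightarrow> f \<in> extensional (ran \<delta>) \<and>
     (\<forall>q x. \<delta> q = Some x \<longrightarrow> (\<exists>r. associate_apply p q = Some r \<and> \<epsilon> r = Some (f x)))"
    (is "_ \<longleftrightarrow> ?P f")
proof -
  have u: "g = f" if f: "?P f" and g: "?P g" for f g
  proof (rule extensionalityI)
    show "g \<in> extensional (ran \<delta>)" using g by (rule conjunct1)
    show "f \<in> extensional (ran \<delta>)" using f by (rule conjunct1)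
    fix x assume "x \<in> ran \<delta>"
    then obtain q where q: "\<delta> q = Some x" unfolding ran_def by blast
    obtain r where r: "associate_apply p q = Some r" "\<epsilon> r = Some (f x)"
      using f q by blast
    obtain r' where r': "associate_apply p q = Some r'" "\<epsilon> r' = Some (g x)"
      using g q by blast
    from r r' show "g x = f x" by simp
  qed
  show ?thesis
    unfolding fun_rep_def by (rule partial_of_functional) (rule u)
qed

lemma cauchy_rep_eq_Some:
  "cauchy_rep a p = Some x \<longleftrightarrow>
     (\<exists>s. (\<forall>i. nat_rep (component p i) = Some (s i)) \<and>
       (\<forall>i j. i < j \<longrightarrow> dist (a (s i)) (a (s j)) \<le> (1/2) ^ i) \<and> (\<lambda>i. a (s i)) \<longlonglongrightarrow> x)"
    (is "_ \<longleftrightarrow> ?P x")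
proof -
  have u: "z = x" if x: "?P x" and z: "?P z" for x z
  proof -
    obtain s where s: "\<forall>i. nat_rep (component p i) = Some (s i)" "(\<lambda>i. a (s i)) \<longlonglongrightarrow> x"
      using x by blast
    obtain t where t: "\<forall>i. nat_rep (component p i) = Some (t i)" "(\<lambda>i. a (t i)) \<longlonglongrightarrow> z"
      using z by blast
    have "t = s" using s(1) t(1) by (intro ext) simp
    with s(2) t(2) show ?thesis by (simp add: LIMSEQ_unique)
  qed
  show ?thesis
    unfolding cauchy_rep_def by (rule partial_of_functional) (rule u)
qed

lemma delta2_rep_eq_Some:
  "delta2_rep a p = Some D \<longleftrightarrow>
     (\<exists>S. fun_rep nat_rep (prod_rep (closed_rep a) (open_rep a)) p = Some S \<and>
       D = (\<Union>i. fst (S i)) \<and> D = (\<Inter>i. snd (S i)))"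
    (is "_ \<longleftrightarrow> ?P D")
proof -
  have u: "E = D" if D: "?P D" and E: "?P E" for D E
  proof -
    obtain S where S: "fun_rep nat_rep (prod_rep (closed_rep a) (open_rep a)) p = Some S"
      "D = (\<Union>i. fst (S i))" using D by blast
    obtain T where T: "fun_rep nat_rep (prod_rep (closed_rep a) (open_rep a)) p = Some T"
      "E = (\<Union>i. fst (T i))" using E by blast
    from S(1) T(1) have "T = S" by simp
    with S(2) T(2) show ?thesis by simp
  qed
  show ?thesis
    unfolding delta2_rep_def by (rule partial_of_functional) (rule u)
qed

lemma delta2_fun_rep_eq_Some:
  "delta2_fun_rep a b p = Some f \<longleftrightarrow>
     fun_rep (open_rep b) (delta2_rep a) p = Some (restrict (\<lambda>U. f -` U) {U. open U})"
proof -
  have u: "g = f" if f: "F = Some (restrict (\<lambda>U. f -` U) {U. open U})"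
    and g: "F = Some (restrict (\<lambda>U. g -` U) {U. open U})" for f g :: "'a \<Rightarrow> 'b" and F
  proof
    fix x
    have "restrict (\<lambda>U. f -` U) {U. open U} = restrict (\<lambda>U. g -` U) {U. open U}"
      using f g by simp
    from fun_cong[OF this, of "- {f x}"] have "f -` (- {f x}) = g -` (- {f x})"
      by (simp add: open_Compl)
    then show "g x = f x" by blast
  qed
  show ?thesis
    unfolding delta2_fun_rep_def by (rule partial_of_functional) (rule u)
qed

lemma open_rational_ball: "open (rational_ball a m)"
  by (simp add: rational_ball_def)

lemma ran_open_rep:
  fixes a :: "nat \<Rightarrow> 'a::metric_space"
  assumes dense: "closure (range a) = UNIV"
  shows "ran (open_rep a) = {U. open U}"
proof (intro equalityI subsetI)
  fix U assume "U \<in> ran (open_rep a)"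
  then show "U \<in> {U. open U}"
    by (auto simp: ran_def open_rep_def open_rational_ball)
next
  fix U :: "'a set" assume "U \<in> {U. open U}"
  then have U: "open U" by simp
  define p where "p n = (rational_ball a (snd (prod_decode n)) \<subseteq> U)" for n
  have "enumerated p = {m. rational_ball a m \<subseteq> U}"
    by (simp add: enumerated_def p_def)
  moreover have "U \<subseteq> (\<Union>m\<in>{m. rational_ball a m \<subseteq> U}. rational_ball a m)"
  proof
    fix x assume "x \<in> U"
    then obtain e where e: "e > 0" "ball x e \<subseteq> U" using U open_contains_ball by blast
    obtain n :: nat where n: "inverse (real (Suc n)) < e / 2"
      using reals_Archimedean[of "e / 2"] e by auto
    have "x \<in> closure (range a)" using dense by simp
    moreover have "inverse (real (Suc n)) > 0" by simp
    ultimately obtain i where i: "dist (a i) x < inverse (real (Suc n))"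
      unfolding closure_approachable by blast
    define m where "m = prod_encode (i, prod_encode (1, n))"
    have m: "rational_ball a m = ball (a i) (inverse (real (Suc n)))"
      by (simp add: m_def rational_ball_def rat_of_code_def inverse_eq_divide)
    have "ball (a i) (inverse (real (Suc n))) \<subseteq> ball x e"
    proof
      fix y assume "y \<in> ball (a i) (inverse (real (Suc n)))"
      then have "dist (a i) y < inverse (real (Suc n))" by simp
      with i n have "dist x y < e"
        using dist_triangle3[of x y "a i"] by linarith
      then show "y \<in> ball x e" by simp
    qed
    with e m have "rational_ball a m \<subseteq> U" by blast
    moreover have "x \<in> rational_ball a m" using m i by simp
    ultimately show "x \<in> (\<Union>m\<in>{m. rational_ball a m \<subseteq> U}. rational_ball a m)" by blast
  qed
  moreover have "(\<Union>m\<in>{m. rational_ball a m \<subseteq> U}. rational_ball a m) \<subseteq> U"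
    by blast
  ultimately have "open_rep a p = Some U"
    by (simp add: open_rep_def subset_antisym)
  then show "U \<in> ran (open_rep a)" by (auto simp: ran_def)
qed

lemma ran_closed_rep:
  fixes a :: "nat \<Rightarrow> 'a::metric_space"
  assumes "closure (range a) = UNIV"
  shows "ran (closed_rep a) = {A. closed A}"
proof -
  have "ran (closed_rep a) = uminus ` ran (open_rep a)"
    by (auto simp: ran_def closed_rep_def open_rep_def)
  also have "\<dots> = {A. closed A}"
  proof (intro equalityI subsetI)
    fix A :: "'a set" assume "A \<in> {A. closed A}"
    then have "A = - (- A)" "- A \<in> ran (open_rep a)"
      by (simp_all add: ran_open_rep[OF assms] open_Compl)
    then show "A \<in> uminus ` ran (open_rep a)" by (rule image_eqI)
  qed (auto simp: ran_open_rep[OF assms] closed_Compl)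
  finally show ?thesis .
qed

lemma ran_cauchy_rep:
  fixes a :: "nat \<Rightarrow> 'a::metric_space"
  assumes dense: "closure (range a) = UNIV"
  shows "ran (cauchy_rep a) = UNIV"
proof -
  have "\<exists>p. cauchy_rep a p = Some x" for x
  proof -
    have "\<exists>n. dist (a n) x < (1/2) ^ Suc i" for i
    proof -
      have "x \<in> closure (range a)" using dense by simp
      moreover have "(1/2::real) ^ Suc i > 0" by simp
      ultimately show ?thesis
        unfolding closure_approachable by blast
    qed
    then obtain s where s: "\<And>i. dist (a (s i)) x < (1/2) ^ Suc i" by metis
    define p where "p n = (case prod_decode n of (i, m) \<Rightarrow> m = s i)" for n
    have "component p i = (\<lambda>m. m = s i)" for i
      by (auto simp: component_def p_def)
    then have "nat_rep (component p i) = Some (s i)" for i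
      by (simp add: nat_rep_def Least_equality)
    moreover have "dist (a (s i)) (a (s j)) \<le> (1/2) ^ i" if "i < j" for i j
    proof -
      have "(1/2::real) ^ j \<le> (1/2) ^ i"
        using that by (intro power_decreasing) auto
      moreover have "2 * dist (a (s k)) x < (1/2) ^ k" for k
        using s[of k] by simp
      ultimately show ?thesis
        using dist_triangle2[of "a (s i)" "a (s j)" x] by (smt (verit))
    qed
    moreover have "(\<lambda>i. a (s i)) \<longlonglongrightarrow> x"
    proof (rule metric_tendsto_imp_tendsto)
      show "(\<lambda>i. (1/2::real) ^ Suc i) \<longlonglongrightarrow> 0"
        by (intro LIMSEQ_Suc LIMSEQ_power_zero) simp
      show "\<forall>\<^sub>F i in sequentially. dist (a (s i)) x \<le> dist ((1/2::real) ^ Suc i) 0"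
        using s by (intro always_eventually allI) (simp add: less_imp_le)
    qed
    ultimately show ?thesis
      unfolding cauchy_rep_eq_Some by blast
  qed
  then show ?thesis by (auto simp: ran_def)
qed

end

theory Submission imports Defs begin

text \<open>
  Let \<open>y = f x\<close>. For a name \<open>q\<close> of an open set \<open>U\<close>, the name of \<open>f\<close> yields open sets
  \<open>U\<^sub>i(q)\<close> with intersection \<open>f -` U\<close>. For an index \<open>(i, w)\<close>, \<open>w\<close> a finite word, consider
  the set \<open>E\<close> of all balls \<open>B\<close> such that \<open>x\<close> lies in \<open>U\<^sub>i(q)\<close> for the name \<open>q\<close> that extends \<open>w\<close>
  by listing only \<open>B\<close>. It is enumerable and contains every ball around \<open>y\<close>. By a Baire category
  argument on the names of open sets avoiding \<open>y\<close>, some index is exact: its \<open>E\<close> consists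
  precisely of the balls containing \<open>y\<close>. Exactness need not be co-enumerable, but the weaker property
  that balls of equal radius in \<open>E\<close> have close centres is, so closed choice on \<open>\<nat>\<close> finds an index
  with it; since \<open>E\<close> contains arbitrarily small balls around \<open>y\<close>, this property already forces
  the balls in \<open>E\<close> to be near \<open>y\<close>, and searching \<open>E\<close> for small balls computes \<open>y\<close>.
\<close>

subsection \<open>Closure properties of total oracle computability\<close>

abbreviation pfst :: "nat \<Rightarrow> nat" where "pfst n \<equiv> fst (prod_decode n)"
abbreviation psnd :: "nat \<Rightarrow> nat" where "psnd n \<equiv> snd (prod_decode n)"

text \<open>Restricting to total programs frees the closure rules below from definedness conditions,
  so that \<open>intro computable\<close> can chain them.\<close>

definition computable_fn :: "(cantor \<Rightarrow> nat \<Rightarrow> nat) \<Rightarrow> bool" where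
  "computable_fn f \<longleftrightarrow> oracle_recursive (\<lambda>p n. Some (f p n))"

definition decidable :: "(cantor \<Rightarrow> nat \<Rightarrow> bool) \<Rightarrow> bool" where
  "decidable P \<longleftrightarrow> computable_fn (\<lambda>p n. of_bool (P p n))"

named_theorems computable

lemma computable_fn_comp:
  assumes "computable_fn f" "computable_fn g"
  shows "computable_fn (\<lambda>p n. f p (g p n))"
  using oracle_recursive.comp[OF assms(2,1)[unfolded computable_fn_def]]
  by (simp add: computable_fn_def)

lemma computable_fn_pair [computable]:
  assumes "computable_fn f" "computable_fn g"
  shows "computable_fn (\<lambda>p n. prod_encode (f p n, g p n))"
  using oracle_recursive.pair[OF assms[unfolded computable_fn_def]]
  by (simp add: computable_fn_def)

lemma computable_fn_fst [computable]: "computable_fn f \<Longrightarrow> computable_fn (\<lambda>p n. pfst (f p n))"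
  and computable_fn_snd [computable]: "computable_fn f \<Longrightarrow> computable_fn (\<lambda>p n. psnd (f p n))"
  and computable_fn_Suc [computable]: "computable_fn f \<Longrightarrow> computable_fn (\<lambda>p n. Suc (f p n))"
  and decidable_query [computable]: "computable_fn f \<Longrightarrow> decidable (\<lambda>p n. p (f p n))"
  using computable_fn_comp[of "\<lambda>p. pfst" f] computable_fn_comp[of "\<lambda>p. psnd" f]
    computable_fn_comp[of "\<lambda>p. Suc" f] computable_fn_comp[of "\<lambda>p n. of_bool (p n)" f]
    oracle_recursive.left oracle_recursive.right oracle_recursive.succ oracle_recursive.query
  by (simp_all add: computable_fn_def decidable_def)

text \<open>The identity is not among the basic operations; it arises by re-pairing the two
  projections.\<close>

lemma computable_fn_id [computable]: "computable_fn (\<lambda>p n. n)"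
proof -
  have "computable_fn (\<lambda>p n. prod_encode (pfst n, psnd n))"
    using computable_fn_pair[of "\<lambda>p. pfst" "\<lambda>p. psnd"] oracle_recursive.left oracle_recursive.right
    by (simp add: computable_fn_def)
  then show ?thesis by simp
qed

lemma computable_fn_0 [computable]: "computable_fn (\<lambda>p n. 0)"
  unfolding computable_fn_def by (rule oracle_recursive.zero)

lemma computable_fn_numeral [computable]: "computable_fn (\<lambda>p n. numeral w)"
proof -
  have "computable_fn (\<lambda>p n. k)" for k
    by (induction k) (intro computable | assumption)+
  then show ?thesis .
qed

lemma computable_fn_1 [computable]: "computable_fn (\<lambda>p n. 1)"
  unfolding One_nat_def by (intro computable)

lemma computable_fn_rec [computable]:
  assumes f: "computable_fn f"
    and g: "computable_fn (\<lambda>p n. g p (pfst n) (pfst (psnd n)) (psnd (psnd n)))"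
    and h: "computable_fn h"
  shows "computable_fn (\<lambda>p n. rec_nat (f p n) (g p n) (h p n))"
proof -
  have "rec_nat (Some (f p x)) (\<lambda>m r. Option.bind r (\<lambda>v. Some (g p x m v))) k
      = Some (rec_nat (f p x) (g p x) k)" for p x k
    by (induction k) auto
  then have "oracle_recursive (\<lambda>p n. case prod_decode n of (x, k) \<Rightarrow> Some (rec_nat (f p x) (g p x) k))"
    using oracle_recursive.prim_rec[OF f[unfolded computable_fn_def] g[unfolded computable_fn_def]]
    by simp
  then have "computable_fn (\<lambda>p n. rec_nat (f p (pfst n)) (g p (pfst n)) (psnd n))"
    by (simp add: computable_fn_def case_prod_beta')
  from computable_fn_comp[OF this computable_fn_pair[OF computable_fn_id h]]
  show ?thesis by simp
qed

section \<open>Arithmetic on natural numbers\<close>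

lemma rec_nat_add_eq: "m + n = rec_nat m (\<lambda>_. Suc) n"
  by (induction n) simp_all

lemma computable_fn_add [computable]:
  assumes "computable_fn f" "computable_fn g"
  shows "computable_fn (\<lambda>p n. f p n + g p n)"
proof -
  have "f p n + g p n = rec_nat (f p n) (\<lambda>_. Suc) (g p n)" for p n
    using rec_nat_add_eq .
  moreover have "computable_fn (\<lambda>p n. rec_nat (f p n) (\<lambda>_. Suc) (g p n))"
    by (intro computable assms)
  ultimately show ?thesis by simp
qed

lemma computable_fn_mult [computable]:
  assumes "computable_fn f" "computable_fn g"
  shows "computable_fn (\<lambda>p n. f p n * g p n)"
proof -
  have "m * n = rec_nat 0 (\<lambda>_ v. m + v) n" for m n :: nat
    by (induction n) simp_all
  moreover have "computable_fn (\<lambda>p n. rec_nat 0 (\<lambda>_ v. f p n + v) (g p n))"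
    by (intro computable computable_fn_comp[OF assms(1)] assms(2))
  ultimately show ?thesis by simp
qed

lemma computable_fn_diff [computable]:
  assumes "computable_fn f" "computable_fn g"
  shows "computable_fn (\<lambda>p n. f p n - g p n)"
proof -
  have pred: "n - 1 = rec_nat 0 (\<lambda>m _. m) n" for n :: nat
    by (cases n) simp_all
  have "rec_nat m (\<lambda>_ v. v - 1) n = m - n" for m n :: nat
    by (induction n) simp_all
  moreover have "computable_fn (\<lambda>p n. rec_nat (f p n) (\<lambda>_ v. v - 1) (g p n))"
    unfolding pred by (intro computable assms)
  ultimately show ?thesis by (simp only:)
qed

lemma computable_fn_power [computable]:
  assumes "computable_fn f" "computable_fn g"
  shows "computable_fn (\<lambda>p n. f p n ^ g p n)"
proof -
  have "m ^ n = rec_nat 1 (\<lambda>_ v. m * v) n" for m n :: nat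
    by (induction n) simp_all
  moreover have "computable_fn (\<lambda>p n. rec_nat 1 (\<lambda>_ v. f p n * v) (g p n))"
    by (intro computable computable_fn_comp[OF assms(1)] assms(2))
  ultimately show ?thesis by simp
qed

section \<open>Decidable predicates and bounded quantification\<close>

lemma computable_fn_of_bool [computable]:
  "decidable P \<Longrightarrow> computable_fn (\<lambda>p n. of_bool (P p n))"
  by (simp add: decidable_def)

lemma decidable_comp:
  assumes "decidable P" "computable_fn g"
  shows "decidable (\<lambda>p n. P p (g p n))"
  using computable_fn_comp[OF assms(1)[unfolded decidable_def] assms(2)]
  by (simp add: decidable_def)

lemma decidable_comp2:
  assumes "decidable (\<lambda>p n. P p (pfst n) (psnd n))" "computable_fn f" "computable_fn g"
  shows "decidable (\<lambda>p n. P p (f p n) (g p n))"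
  using decidable_comp[OF assms(1) computable_fn_pair[OF assms(2,3)]] by simp

lemma decidable_not [computable]:
  assumes "decidable P"
  shows "decidable (\<lambda>p n. \<not> P p n)"
proof -
  have "computable_fn (\<lambda>p n. 1 - of_bool (P p n))"
    by (intro computable assms)
  moreover have "1 - of_bool Q = (of_bool (\<not> Q) :: nat)" for Q
    by simp
  ultimately show ?thesis by (simp only: decidable_def)
qed

lemma decidable_conj [computable]:
  assumes "decidable P" "decidable Q"
  shows "decidable (\<lambda>p n. P p n \<and> Q p n)"
  unfolding decidable_def of_bool_conj by (intro computable assms)

lemma decidable_less [computable]:
  assumes "computable_fn f" "computable_fn g"
  shows "decidable (\<lambda>p n. f p n < g p n)"
proof -
  have "computable_fn (\<lambda>p n. 1 - (1 - (g p n - f p n)))"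
    by (intro computable assms)
  moreover have "1 - (1 - (m - n)) = of_bool (n < m)" for m n :: nat
    by simp
  ultimately show ?thesis by (simp add: decidable_def)
qed

lemma decidable_eq [computable]:
  assumes "computable_fn f" "computable_fn g"
  shows "decidable (\<lambda>p n. f p n = g p n)"
proof -
  have "decidable (\<lambda>p n. \<not> f p n < g p n \<and> \<not> g p n < f p n)"
    by (intro computable assms)
  then show ?thesis by (simp add: not_less eq_iff conj_commute)
qed

lemma computable_fn_If [computable]:
  assumes "decidable P" "computable_fn f" "computable_fn g"
  shows "computable_fn (\<lambda>p n. if P p n then f p n else g p n)"
proof -
  have "computable_fn (\<lambda>p n. of_bool (P p n) * f p n + of_bool (\<not> P p n) * g p n)"
    by (intro computable assms)
  moreover have "of_bool (P p n) * f p n + of_bool (\<not> P p n) * g p n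
      = (if P p n then f p n else g p n)" for p n
    by simp
  ultimately show ?thesis by simp
qed

lemma decidable_If [computable]:
  assumes "decidable P" "decidable Q" "decidable R"
  shows "decidable (\<lambda>p n. if P p n then Q p n else R p n)"
proof -
  have "computable_fn (\<lambda>p n. if P p n then of_bool (Q p n) else of_bool (R p n))"
    by (intro computable assms)
  then show ?thesis
    unfolding decidable_def by (simp add: if_distrib)
qed

lemma decidable_all_less [computable]:
  assumes "decidable (\<lambda>p n. P p (pfst n) (psnd n))" "computable_fn h"
  shows "decidable (\<lambda>p n. \<forall>m<h p n. P p n m)"
proof -
  have "(of_bool (\<forall>m<k. Q m) :: nat) = rec_nat 1 (\<lambda>m v. v * of_bool (Q m)) k" for k :: nat and Q
    by (induction k) (simp_all add: All_less_Suc of_bool_conj mult.commute)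
  moreover have "computable_fn (\<lambda>p n. rec_nat 1 (\<lambda>m v. v * of_bool (P p n m)) (h p n))"
    by (intro computable decidable_comp2[OF assms(1)] assms(2))
  ultimately show ?thesis by (simp add: decidable_def)
qed

text \<open>Finding the first set bit takes an unbounded search, but checking that it sits at a
  given position only reads the bits up to there.\<close>

lemma decidable_nat_rep [computable]:
  assumes "decidable (\<lambda>p n. Q p (pfst n) (psnd n))" "computable_fn f"
  shows "decidable (\<lambda>p n. nat_rep (Q p n) = Some (f p n))"
proof -
  have *: "nat_rep q = Some s \<longleftrightarrow> q s \<and> (\<forall>i<s. \<not> q i)" for q s
  proof
    assume *: "nat_rep q = Some s"
    then have "\<exists>n. q n" and s: "s = (LEAST n. q n)"
      unfolding nat_rep_def by (metis option.distinct(1), metis option.distinct(1) option.sel)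
    then show "q s \<and> (\<forall>i<s. \<not> q i)"
      unfolding s using LeastI_ex not_less_Least by blast
  next
    assume *: "q s \<and> (\<forall>i<s. \<not> q i)"
    then have "(LEAST n. q n) = s"
      by (blast intro: Least_equality leI)
    with * show "nat_rep q = Some s"
      unfolding nat_rep_def by simp blast
  qed
  show ?thesis
    unfolding * by (intro computable decidable_comp2[OF assms(1)] assms(2))
qed

text \<open>\<open>list_encode\<close> adds entries at the head, so the recursion runs through the
  suffixes of the prefix, starting from its last bit.\<close>

lemma prefix_code_rec:
  "prefix_code q k = rec_nat 0 (\<lambda>j v. Suc (prod_encode (of_bool (q (k - Suc j)), v))) k"
proof -
  have "list_encode (map (\<lambda>i. of_bool (q i)) [k - j..<k])
      = rec_nat 0 (\<lambda>j v. Suc (prod_encode (of_bool (q (k - Suc j)), v))) j" if "j \<le> k" for j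
    using that
  proof (induction j)
    case (Suc j)
    then have "[k - Suc j..<k] = (k - Suc j) # [k - j..<k]"
      by (simp add: upt_conv_Cons Suc_diff_Suc)
    with Suc show ?case by simp
  qed simp
  from this[of k] show ?thesis by (simp add: prefix_code_def)
qed

lemma computable_fn_prefix_code [computable]:
  assumes "decidable (\<lambda>p n. Q p (pfst n) (psnd n))" "computable_fn k"
  shows "computable_fn (\<lambda>p n. prefix_code (Q p n) (k p n))"
  unfolding prefix_code_rec
  by (intro computable decidable_comp2[OF assms(1)] computable_fn_comp[OF assms(2)] assms(2))

text \<open>A number codes an infinite word, finitely many bits of which can be prescribed.\<close>

definition word_bit :: "nat \<Rightarrow> nat \<Rightarrow> bool" where
  "word_bit c n \<longleftrightarrow> pfst (rec_nat c (\<lambda>_. psnd) n) = 1"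

lemma decidable_word_bit [computable]:
  assumes "computable_fn c" "computable_fn f"
  shows "decidable (\<lambda>p n. word_bit (c p n) (f p n))"
  unfolding word_bit_def by (intro computable assms)

lemma word_bit_prod_encode:
  "word_bit (prod_encode (u, c)) n \<longleftrightarrow> (case n of 0 \<Rightarrow> u = 1 | Suc m \<Rightarrow> word_bit c m)"
proof -
  have "rec_nat (prod_encode (u, c)) (\<lambda>_. psnd) (Suc m) = rec_nat c (\<lambda>_. psnd) m" for m
    by (induction m) simp_all
  then show ?thesis by (cases n) (simp_all add: word_bit_def)
qed

lemma ex_word_bit: "\<exists>c. \<forall>n<L. word_bit c n = q n"
proof (induction L arbitrary: q)
  case (Suc L)
  from Suc[of "\<lambda>n. q (Suc n)"] obtain c where "\<forall>n<L. word_bit c n = q (Suc n)" by blast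
  then have "\<forall>n<Suc L. word_bit (prod_encode (of_bool (q 0), c)) n = q n"
    by (auto simp: word_bit_prod_encode split: nat.split)
  then show ?case by blast
qed simp

text \<open>Only \<open>query\<close> looks at the oracle, and there a program for \<open>T\<close>
  can answer instead. This lets programs run on one half of a paired oracle.\<close>

lemma oracle_recursive_subst:
  assumes "oracle_recursive \<phi>" and T: "decidable T"
  shows "oracle_recursive (\<lambda>p. \<phi> (T p))"
  using assms(1)
proof induction
  case query
  then show ?case using T by (simp add: decidable_def computable_fn_def)
next
  case zero
  show ?case by (rule oracle_recursive.zero)
next
  case succ
  show ?case by (rule oracle_recursive.succ)
next
  case left
  show ?case by (rule oracle_recursive.left)
next
  case right
  show ?case by (rule oracle_recursive.right)
next
  case (pair \<phi> \<psi>)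
  show ?case using pair.IH by (rule oracle_recursive.pair)
next
  case (comp \<phi> \<psi>)
  show ?case using comp.IH by (rule oracle_recursive.comp)
next
  case (prim_rec \<phi> \<psi>)
  show ?case using prim_rec.IH by (rule oracle_recursive.prim_rec)
next
  case (minimize \<phi>)
  show ?case using minimize.IH by (rule oracle_recursive.minimize)
qed

lemma decidable_subst:
  assumes "decidable P" "decidable T"
  shows "decidable (\<lambda>p. P (T p))"
  using oracle_recursive_subst[OF assms(1)[unfolded decidable_def computable_fn_def] assms(2)]
  unfolding decidable_def computable_fn_def .

lemma oracle_recursive_search:
  assumes P: "decidable (\<lambda>p n. P p (pfst n) (psnd n))"
    and g: "computable_fn (\<lambda>p n. g p (pfst n) (psnd n))"
  shows "oracle_recursive
    (\<lambda>p n. if \<exists>z. P p n z then Some (g p n (LEAST z. P p n z)) else None)"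
proof -
  define s where "s p n = (if \<exists>z. P p n z then Some (LEAST z. P p n z) else None)" for p n
  \<comment> \<open>\<open>minimize\<close> searches for the value 0, so it is given the
    characteristic function of the negation.\<close>
  have not: "oracle_recursive (\<lambda>p n. Some (of_bool (\<not> P p (pfst n) (psnd n))))"
    using decidable_not[OF P] unfolding decidable_def computable_fn_def .
  have *: "(of_bool (\<not> Q) :: nat) = 0 \<longleftrightarrow> Q" "(\<exists>v. of_bool (\<not> Q) = Suc v) \<longleftrightarrow> \<not> Q" for Q
    by auto
  from oracle_recursive.minimize[OF not]
  have "oracle_recursive (\<lambda>p. partial_of (\<lambda>n z. P p n z \<and> (\<forall>m<z. \<not> P p n m)))"
    by (simp add: *)
  moreover have "partial_of (\<lambda>n z. P p n z \<and> (\<forall>m<z. \<not> P p n m)) n = s p n" for p n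
  proof (cases "\<exists>z. P p n z")
    case True
    define l where "l = (LEAST z. P p n z)"
    have l: "\<not> P p n m" if "m < l" for m
      using not_less_Least that unfolding l_def by blast
    have "P p n l" using True LeastI_ex unfolding l_def by blast
    then have "partial_of (\<lambda>n z. P p n z \<and> (\<forall>m<z. \<not> P p n m)) n = Some l"
      unfolding partial_of_eq_Some using l linorder_neq_iff by blast
    with True show ?thesis by (simp add: s_def l_def)
  qed (auto simp: s_def partial_of_def)
  then have "(\<lambda>p. partial_of (\<lambda>n z. P p n z \<and> (\<forall>m<z. \<not> P p n m))) = s"
    by blast
  ultimately have s: "oracle_recursive s"
    by (simp only:)
  have "oracle_recursive (\<lambda>p n. Some n)" "oracle_recursive (\<lambda>p n. Some (g p (pfst n) (psnd n)))"
    using computable_fn_id g by (simp_all add: computable_fn_def)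
  from oracle_recursive.comp[OF oracle_recursive.pair[OF this(1) s] this(2)]
  have "oracle_recursive (\<lambda>p n. Option.bind (s p n) (\<lambda>z. Some (g p n z)))"
    by simp
  moreover have "Option.bind (s p n) (\<lambda>z. Some (g p n z))
      = (if \<exists>z. P p n z then Some (g p n (LEAST z. P p n z)) else None)" for p n
    by (simp add: s_def)
  ultimately show ?thesis by (simp only:)
qed


subsection \<open>Balls detected by an index\<close>

text \<open>Outputs of associates serve below as enumerations, so only triples asserting the bit 1
  are sought. The witness \<open>z\<close> pairs a prefix length with an enumeration stage.\<close>

definition associate_bit :: "cantor \<Rightarrow> cantor \<Rightarrow> nat \<Rightarrow> nat \<Rightarrow> bool" where
  "associate_bit F q n z \<longleftrightarrow>
     F (prod_encode (psnd z, prod_encode (prefix_code q (pfst z), prod_encode (n, 1))))"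

lemma associate_apply_bit:
  assumes "associate_apply F q = Some r"
  shows "r n \<longleftrightarrow> (\<exists>z. associate_bit F q n z)"
proof -
  have "r n \<longleftrightarrow> (\<exists>k. prod_encode (prefix_code q k, prod_encode (n, of_bool True)) \<in> enumerated F)"
    using assms unfolding associate_apply_eq_Some by blast
  also have "\<dots> \<longleftrightarrow> (\<exists>k t. associate_bit F q n (prod_encode (k, t)))"
    by (simp add: enumerated_def associate_bit_def)
  also have "\<dots> \<longleftrightarrow> (\<exists>z. associate_bit F q n z)"
    by (metis prod_decode_inverse surj_pair)
  finally show ?thesis .
qed

lemma associate_bit_cong:
  assumes "\<And>n. n < pfst z \<Longrightarrow> q' n = q n"
  shows "associate_bit F q' n z = associate_bit F q n z"
proof -
  have "prefix_code q' (pfst z) = prefix_code q (pfst z)"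
    unfolding prefix_code_def using assms by (intro arg_cong[where f = list_encode] map_cong) auto
  then show ?thesis by (simp add: associate_bit_def)
qed

section \<open>Preimages of open sets\<close>

text \<open>
  For a name \<open>F\<close> of \<open>f\<close> and a name \<open>q\<close> of an open set \<open>U\<close>, \<open>preimage_bit F q i m w\<close> says that
  \<open>w\<close> witnesses that ball \<open>m\<close> is listed in the \<open>i\<close>-th open set in the \<open>\<Delta>\<^sup>0\<^sub>2\<close> name
  of \<open>f -` U\<close>. Two associates are involved: \<open>F\<close> itself and the sequence of sets it outputs.
\<close>

definition preimage_bit :: "cantor \<Rightarrow> cantor \<Rightarrow> nat \<Rightarrow> nat \<Rightarrow> nat \<Rightarrow> bool" where
  "preimage_bit F q i m w \<longleftrightarrow>
     (let t = pfst w; z = pfst (psnd w); z' = psnd (psnd w) in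
       associate_bit F q
         (prod_encode (psnd z, prod_encode (prefix_code (\<lambda>n. n = i) (pfst z),
            prod_encode (2 * prod_encode (t, m) + 1, 1)))) z')"

text \<open>Continuity in the name of the open set: a fixed witness reads only a finite prefix of
  \<open>q\<close>.\<close>

lemma preimage_bit_cong:
  "\<exists>N. \<forall>q'. (\<forall>n<N. q' n = q n) \<longrightarrow> preimage_bit F q' i m w = preimage_bit F q i m w"
  unfolding preimage_bit_def Let_def using associate_bit_cong by blast

lemma vimage_eq_Inter_preimage_bit:
  fixes a :: "nat \<Rightarrow> 'a::metric_space" and b :: "nat \<Rightarrow> 'b::metric_space"
  assumes dense: "closure (range b) = UNIV" and F: "delta2_fun_rep a b F = Some f"
    and q: "open_rep b q = Some U"
  shows "f -` U = (\<Inter>i. \<Union>m\<in>{m. \<exists>w. preimage_bit F q i m w}. rational_ball a m)"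
proof -
  have "U \<in> ran (open_rep b)" using q by (auto simp: ran_def)
  then have U: "open U" using dense by (simp add: ran_open_rep)
  obtain s where s: "associate_apply F q = Some s" "delta2_rep a s = Some (f -` U)"
    using F q U unfolding delta2_fun_rep_eq_Some fun_rep_eq_Some by (metis mem_Collect_eq restrict_apply')
  obtain S where S: "fun_rep nat_rep (prod_rep (closed_rep a) (open_rep a)) s = Some S"
    "f -` U = (\<Inter>i. snd (S i))"
    using s(2) unfolding delta2_rep_eq_Some by blast
  have "snd (S i) = (\<Union>m\<in>{m. \<exists>w. preimage_bit F q i m w}. rational_ball a m)" for i
  proof -
    have "nat_rep (\<lambda>n. n = i) = Some i" by (simp add: nat_rep_def Least_equality)
    then obtain r where r: "associate_apply s (\<lambda>n. n = i) = Some r"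
      "prod_rep (closed_rep a) (open_rep a) r = Some (S i)"
      using S(1) unfolding fun_rep_eq_Some by blast
    have "open_rep a (csnd r) = Some (snd (S i))"
      using r(2) by (cases "S i") (auto simp: prod_rep_def bind_eq_Some_conv)
    then have "snd (S i) = (\<Union>m\<in>enumerated (csnd r). rational_ball a m)"
      by (simp add: open_rep_def)
    have "m \<in> enumerated (csnd r) \<longleftrightarrow> (\<exists>w. preimage_bit F q i m w)" for m
    proof -
      \<comment> \<open>The open set is the second component of \<open>r\<close>, hence the odd
        positions.\<close>
      have "m \<in> enumerated (csnd r) \<longleftrightarrow> (\<exists>t z. associate_bit s (\<lambda>n. n = i) (2 * prod_encode (t, m) + 1) z)"
        by (simp add: enumerated_def csnd_def associate_apply_bit[OF r(1)])
      also have "\<dots> \<longleftrightarrow> (\<exists>t z z'. preimage_bit F q i m (prod_encode (t, prod_encode (z, z'))))"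
        unfolding associate_bit_def[of s] associate_apply_bit[OF s(1)] by (simp add: preimage_bit_def)
      also have "\<dots> \<longleftrightarrow> (\<exists>w. preimage_bit F q i m w)"
        by (metis prod_decode_inverse surj_pair)
      finally show ?thesis .
    qed
    then have "enumerated (csnd r) = {m. \<exists>w. preimage_bit F q i m w}" by blast
    with \<open>snd (S i) = _\<close> show ?thesis by simp
  qed
  with S(2) show ?thesis by simp
qed

section \<open>Semideciding membership in rational balls\<close>

text \<open>
  The slack \<open>2 * (1/2) ^ j\<close> covers the error of \<open>d\<close> and the distance of the \<open>j\<close>-th
  approximation in the Cauchy name \<open>X\<close> from its limit.
\<close>

definition in_ball_at :: "(nat \<Rightarrow> nat) \<Rightarrow> cantor \<Rightarrow> nat \<Rightarrow> nat \<Rightarrow> nat \<Rightarrow> bool" where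
  "in_ball_at d X m j s \<longleftrightarrow> nat_rep (component X j) = Some s \<and>
     rat_of_code (d (prod_encode (prod_encode (s, pfst m), j))) + 2 * (1/2) ^ j < rat_of_code (psnd m)"

definition approximates :: "(nat \<Rightarrow> 'a::metric_space) \<Rightarrow> (nat \<Rightarrow> nat) \<Rightarrow> bool" where
  "approximates a d \<longleftrightarrow> (\<forall>i j k.
     \<bar>dist (a i) (a j) - rat_of_code (d (prod_encode (prod_encode (i, j), k)))\<bar> \<le> (1/2) ^ k)"

lemma in_ball_at_iff:
  assumes d: "approximates a d" and X: "cauchy_rep a X = Some x"
  shows "(\<exists>j s. in_ball_at d X m j s) \<longleftrightarrow> x \<in> rational_ball a m"
proof -
  obtain s where s: "\<And>i. nat_rep (component X i) = Some (s i)"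
    and c: "\<And>i j. i < j \<Longrightarrow> dist (a (s i)) (a (s j)) \<le> (1/2) ^ i" and l: "(\<lambda>i. a (s i)) \<longlonglongrightarrow> x"
    using X unfolding cauchy_rep_eq_Some by blast
  have x: "dist (a (s i)) x \<le> (1/2) ^ i" for i
  proof (rule tendsto_upperbound)
    show "(\<lambda>j. dist (a (s i)) (a (s j))) \<longlonglongrightarrow> dist (a (s i)) x"
      by (intro tendsto_intros l)
    show "\<forall>\<^sub>F j in sequentially. dist (a (s i)) (a (s j)) \<le> (1/2) ^ i"
      using eventually_gt_at_top[of i] by (rule eventually_mono) (rule c)
  qed simp
  define r where "r j = rat_of_code (d (prod_encode (prod_encode (s j, pfst m), j)))" for j
  have r: "\<bar>dist (a (s j)) (a (pfst m)) - r j\<bar> \<le> (1/2) ^ j" for j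
    using d by (simp add: approximates_def r_def)
  have "(\<exists>j s. in_ball_at d X m j s) \<longleftrightarrow> (\<exists>j. r j + 2 * (1/2) ^ j < rat_of_code (psnd m))"
    by (simp add: in_ball_at_def s r_def)
  also have "\<dots> \<longleftrightarrow> dist (a (pfst m)) x < rat_of_code (psnd m)"
  proof
    assume "\<exists>j. r j + 2 * (1/2) ^ j < rat_of_code (psnd m)"
    then obtain j where "r j + 2 * (1/2) ^ j < rat_of_code (psnd m)" by blast
    with r[of j] x[of j] show "dist (a (pfst m)) x < rat_of_code (psnd m)"
      using dist_triangle3[of "a (pfst m)" x "a (s j)"] by linarith
  next
    assume lt: "dist (a (pfst m)) x < rat_of_code (psnd m)"
    define e where "e = rat_of_code (psnd m) - dist (a (pfst m)) x"
    \<comment> \<open>Four errors of size \<open>(1/2) ^ j\<close> must fit into the margin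
      \<open>e\<close>: two separate \<open>r j\<close> from the true distance, and two form the
      slack.\<close>
    have "e / 4 > 0" using lt by (simp add: e_def)
    then obtain j where "(1/2::real) ^ j < e / 4"
      using real_arch_pow_inv[of "e/4" "1/2"] by auto
    with r[of j] x[of j] have "r j + 2 * (1/2) ^ j < rat_of_code (psnd m)"
      using dist_triangle[of "a (s j)" "a (pfst m)" x] unfolding e_def by (simp add: dist_commute)
    then show "\<exists>j. r j + 2 * (1/2) ^ j < rat_of_code (psnd m)" ..
  qed
  finally show ?thesis by (simp add: rational_ball_def)
qed

text \<open>The word coded by \<open>c\<close>, cut off at \<open>L\<close>, followed by ball \<open>m\<close> and nothing else.\<close>

definition probe :: "nat \<Rightarrow> nat \<Rightarrow> nat \<Rightarrow> cantor" where
  "probe L c m n = (if n < L then word_bit c n else n = prod_encode (L, m))"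

lemma rational_ball_subset_open_rep:
  "open_rep b (probe L c m) = Some U \<Longrightarrow> rational_ball b m \<subseteq> U"
proof -
  have "probe L c m (prod_encode (L, m))"
    \<comment> \<open>The stage \<open>L\<close> puts the position of \<open>m\<close> at or beyond
      the cut-off, so the word cannot overwrite it.\<close>
    using le_prod_encode_1[of L m] by (simp add: probe_def not_less)
  then have "m \<in> enumerated (probe L c m)" unfolding enumerated_def by blast
  then show "open_rep b (probe L c m) = Some U \<Longrightarrow> rational_ball b m \<subseteq> U"
    by (auto simp: open_rep_def)
qed

text \<open>For a fixed index \<open>(i, L, c)\<close>, the detected \<open>m\<close> form the set
  \<open>E\<close> of the introduction.\<close>

definition detects :: "(nat \<Rightarrow> 'a::metric_space) \<Rightarrow> cantor \<Rightarrow> 'a \<Rightarrow> nat \<Rightarrow> nat \<Rightarrow> nat \<Rightarrow> nat \<Rightarrow> bool" where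
  "detects a F x i L c m \<longleftrightarrow> (\<exists>m' w. preimage_bit F (probe L c m) i m' w \<and> x \<in> rational_ball a m')"

text \<open>The set named by the probe includes ball \<open>m\<close> and thus contains
  \<open>f x\<close>, so \<open>x\<close> lies in every set of the intersection describing its
  preimage.\<close>

lemma detects_if_mem:
  assumes "closure (range b) = UNIV" "delta2_fun_rep a b F = Some f" "f x \<in> rational_ball b m"
  shows "detects a F x i L c m"
proof -
  obtain U where U: "open_rep b (probe L c m) = Some U" by (simp add: open_rep_def)
  have "x \<in> f -` U" using rational_ball_subset_open_rep[OF U] assms(3) by blast
  then show ?thesis
    unfolding vimage_eq_Inter_preimage_bit[OF assms(1,2) U] detects_def by blast
qed

text \<open>
  A Baire category argument in the space of names of open sets avoiding \<open>f x\<close>: were every index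
  misled by some ball, the misleading balls could be strung together to a name of an open set
  that avoids \<open>f x\<close> although \<open>x\<close> lies in all open sets describing its preimage.
\<close>

lemma ex_exact_index:
  assumes dense: "closure (range b) = UNIV" and F: "delta2_fun_rep a b F = Some f"
  shows "\<exists>i L c. \<forall>m. detects a F x i L c m \<longrightarrow> f x \<in> rational_ball b m"
proof (rule ccontr)
  assume no: "\<nexists>i L c. \<forall>m. detects a F x i L c m \<longrightarrow> f x \<in> rational_ball b m"
  define avoids where "avoids q \<longleftrightarrow> (\<forall>m\<in>enumerated q. f x \<notin> rational_ball b m)" for q
  define hits where "hits q i \<longleftrightarrow> (\<exists>m w. preimage_bit F q i m w \<and> x \<in> rational_ball a m)" for q i
  \<comment> \<open>Cut \<open>q\<close> off at \<open>N\<close> and append a ball that misleads the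
    resulting index. The new name still avoids \<open>f x\<close>, and finitely many of its bits
    force \<open>x\<close> into the \<open>i\<close>-th open set.\<close>
  have step: "\<exists>q' N'. N < N' \<and> (\<forall>n<N. q' n = q n) \<and> avoids q' \<and>
      (\<forall>q''. (\<forall>n<N'. q'' n = q' n) \<longrightarrow> hits q'' i)" if q: "avoids q" for q N i
  proof -
    obtain c where c: "\<forall>n<N. word_bit c n = q n" using ex_word_bit by blast
    obtain m where m: "detects a F x i N c m" "f x \<notin> rational_ball b m" using no by blast
    let ?q' = "probe N c m"
    obtain m' w where w: "preimage_bit F ?q' i m' w" "x \<in> rational_ball a m'"
      using m(1) unfolding detects_def by blast
    obtain K where K: "\<And>q''. \<forall>n<K. q'' n = ?q' n \<Longrightarrow> preimage_bit F q'' i m' w"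
      using preimage_bit_cong[of ?q' F i m' w] w(1) by blast
    have eq: "\<forall>n<N. ?q' n = q n" using c by (simp add: probe_def)
    have "avoids ?q'"
      unfolding avoids_def
    proof
      fix l assume "l \<in> enumerated ?q'"
      then obtain t where t: "?q' (prod_encode (t, l))" by (auto simp: enumerated_def)
      show "f x \<notin> rational_ball b l"
      proof (cases "prod_encode (t, l) < N")
        case True
        with t eq have "l \<in> enumerated q" by (auto simp: enumerated_def)
        with q show ?thesis by (simp add: avoids_def)
      next
        case False
        with t m(2) show ?thesis by (simp add: probe_def)
      qed
    qed
    moreover have "hits q'' i" if "\<forall>n<max (Suc N) K. q'' n = ?q' n" for q''
      using K[of q''] that w(2) by (auto simp: hits_def)
    ultimately show ?thesis
      using eq by (intro exI[of _ ?q'] exI[of _ "max (Suc N) K"]) auto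
  qed
  \<comment> \<open>A state is a name together with the length of its frozen prefix.\<close>
  define R where "R i s s' \<longleftrightarrow> snd s < snd s' \<and> (\<forall>n<snd s. fst s' n = fst s n) \<and>
      (\<forall>q. (\<forall>n<snd s'. q n = fst s' n) \<longrightarrow> hits q i)" for i and s s' :: "cantor \<times> nat"
  have "avoids (fst (\<lambda>_. False, 0 :: nat))" by (simp add: avoids_def enumerated_def)
  then have "\<exists>s :: cantor \<times> nat. avoids (fst s)" ..
  moreover have "\<exists>s'. avoids (fst s') \<and> R i s s'" if "avoids (fst s)" for s i
    using step[OF that, of "snd s" i] by (auto simp: R_def)
  ultimately have "\<exists>s. \<forall>i. avoids (fst (s i)) \<and> R i (s i) (s (Suc i))"
    by (rule dependent_nat_choice)
  then obtain s where s: "\<And>i. avoids (fst (s i))" "\<And>i. R i (s i) (s (Suc i))" by blast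
  define N where "N i = snd (s i)" for i
  have "strict_mono N"
    using s(2) by (auto simp: strict_mono_Suc_iff N_def R_def)
  then have N: "i \<le> N i" "i \<le> j \<Longrightarrow> N i \<le> N j" for i j
    by (simp_all add: strict_mono_imp_increasing strict_mono_less_eq)
  have agree: "fst (s j) n = fst (s i) n" if "i \<le> j" "n < N i" for i j n
    using that(1)
  proof (induction j rule: dec_induct)
    case (step j)
    have "n < N j" using that(2) N(2)[OF step(1)] by simp
    with step s(2)[of j] show ?case by (auto simp: R_def N_def)
  qed simp
  \<comment> \<open>Stage \<open>Suc n\<close> has frozen more than \<open>n\<close> bits, so bit
    \<open>n\<close> is final there.\<close>
  define q where "q n = fst (s (Suc n)) n" for n
  have q: "q n = fst (s i) n" if "n < N i" for n i
  proof (cases "i \<le> Suc n")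
    case True
    then show ?thesis using agree[OF True that] by (simp only: q_def)
  next
    case False
    have "n < N (Suc n)" using N(1)[of "Suc n"] by simp
    with False show ?thesis using agree[of "Suc n" i n] unfolding q_def by simp
  qed
  have "hits q i" for i
    using s(2)[of i] q[of _ "Suc i"] by (simp add: R_def N_def)
  obtain U where U: "open_rep b q = Some U" by (simp add: open_rep_def)
  have "x \<in> f -` U"
    using \<open>\<And>i. hits q i\<close> unfolding vimage_eq_Inter_preimage_bit[OF dense F U] hits_def by blast
  then obtain m t where m: "q (prod_encode (t, m))" "f x \<in> rational_ball b m"
    using U by (auto simp: open_rep_def enumerated_def)
  \<comment> \<open>Stage \<open>k\<close> already lists this ball around \<open>f x\<close>,
    although every stage avoids \<open>f x\<close>.\<close>
  define k where "k = Suc (prod_encode (t, m))"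
  have "fst (s k) (prod_encode (t, m))"
    using m(1) by (simp add: q_def k_def)
  then show False
    using s(1)[of k] m(2) by (auto simp: avoids_def enumerated_def)
qed


subsection \<open>Reduction to closed choice\<close>

lemma computable_fn_computable_nat:
  assumes "computable_nat d" "computable_fn f"
  shows "computable_fn (\<lambda>p n. d (f p n))"
proof -
  obtain \<phi> where "oracle_recursive \<phi>" "\<And>p n. \<phi> p n = Some (d n)"
    using assms(1) unfolding computable_nat_def by blast
  then have "oracle_recursive (\<lambda>p n. Some (d n))"
    by (metis (no_types, lifting) ext)
  then have "computable_fn (\<lambda>p. d)"
    by (simp add: computable_fn_def)
  from computable_fn_comp[OF this assms(2)] show ?thesis .
qed

lemma decidable_cfst [computable]: "decidable cfst" and decidable_csnd [computable]: "decidable csnd"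
proof -
  have "decidable (\<lambda>p n. p (2 * n))" "decidable (\<lambda>p n. p (2 * n + 1))"
    by (intro computable)+
  then show "decidable cfst" "decidable csnd"
    by (simp_all add: cfst_def[abs_def] csnd_def[abs_def])
qed

lemma decidable_associate_bit:
  assumes "decidable F" "decidable (\<lambda>p n. Q p (pfst n) (psnd n))" "computable_fn f" "computable_fn z"
  shows "decidable (\<lambda>p n. associate_bit (F p) (Q p n) (f p n) (z p n))"
  unfolding associate_bit_def
  by (intro decidable_comp[OF assms(1)] computable assms(2-))

lemma decidable_preimage_bit:
  assumes F: "decidable F" and Q: "decidable (\<lambda>p n. Q p (pfst n) (psnd n))"
    and "computable_fn i" "computable_fn m" "computable_fn w"
  shows "decidable (\<lambda>p n. preimage_bit (F p) (Q p n) (i p n) (m p n) (w p n))"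
  unfolding preimage_bit_def Let_def
  by (intro decidable_associate_bit[OF F Q] computable computable_fn_comp[OF assms(3)] assms(3-))

lemma decidable_probe [computable]:
  assumes "computable_fn L" "computable_fn c" "computable_fn m" "computable_fn f"
  shows "decidable (\<lambda>p n. probe (L p n) (c p n) (m p n) (f p n))"
  unfolding probe_def by (intro computable assms)

text \<open>Clearing the positive denominators turns the comparison of reals into one of natural
  numbers.\<close>

lemma decidable_rat_add_less:
  assumes "computable_fn f" "computable_fn g" "computable_fn j"
  shows "decidable (\<lambda>p n. rat_of_code (f p n) + 2 * (1/2) ^ j p n < rat_of_code (g p n))"
proof -
  have "rat_of_code u + 2 * (1/2) ^ j < rat_of_code v \<longleftrightarrow>
      pfst u * 2 ^ j * Suc (psnd v) + 2 * Suc (psnd u) * Suc (psnd v) < pfst v * Suc (psnd u) * 2 ^ j"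
    for u v j
  proof -
    define A B S T P where "A = real (pfst u)" and "B = real (pfst v)" and "S = real (Suc (psnd u))"
      and "T = real (Suc (psnd v))" and "P = (2::real) ^ j"
    have pos: "S > 0" "T > 0" "P > 0" by (simp_all add: S_def T_def P_def)
    have "rat_of_code u + 2 * (1/2) ^ j < rat_of_code v \<longleftrightarrow> A / S + 2 / P < B / T"
      by (simp add: rat_of_code_def A_def B_def S_def T_def P_def power_one_over)
    also have "\<dots> \<longleftrightarrow> A * P * T + 2 * S * T < B * S * P"
      using pos by (simp add: field_simps)
    also have "\<dots> \<longleftrightarrow> real (pfst u * 2 ^ j * Suc (psnd v) + 2 * Suc (psnd u) * Suc (psnd v))
        < real (pfst v * Suc (psnd u) * 2 ^ j)"
      unfolding A_def B_def S_def T_def P_def by (simp only: of_nat_mult of_nat_add of_nat_power of_nat_numeral)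
    finally show ?thesis by (simp only: of_nat_less_iff)
  qed
  moreover have "decidable (\<lambda>p n. pfst (f p n) * 2 ^ j p n * Suc (psnd (g p n))
      + 2 * Suc (psnd (f p n)) * Suc (psnd (g p n)) < pfst (g p n) * Suc (psnd (f p n)) * 2 ^ j p n)"
    by (intro computable assms)
  ultimately show ?thesis by (simp only:)
qed

lemma decidable_less_rat:
  assumes "computable_fn f" "computable_fn j"
  shows "decidable (\<lambda>p n. 3 * (1/2) ^ j p n < rat_of_code (f p n))"
proof -
  have "3 * (1/2) ^ j < rat_of_code u \<longleftrightarrow> 3 * Suc (psnd u) < pfst u * 2 ^ j" for u j
  proof -
    define A S P where "A = real (pfst u)" and "S = real (Suc (psnd u))" and "P = (2::real) ^ j"
    have pos: "S > 0" "P > 0" by (simp_all add: S_def P_def)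
    have "3 * (1/2) ^ j < rat_of_code u \<longleftrightarrow> 3 / P < A / S"
      by (simp add: rat_of_code_def A_def S_def P_def power_one_over)
    also have "\<dots> \<longleftrightarrow> 3 * S < A * P"
      using pos by (simp add: field_simps)
    also have "\<dots> \<longleftrightarrow> real (3 * Suc (psnd u)) < real (pfst u * 2 ^ j)"
      unfolding A_def S_def P_def by (simp only: of_nat_mult of_nat_power of_nat_numeral)
    finally show ?thesis by (simp only: of_nat_less_iff)
  qed
  moreover have "decidable (\<lambda>p n. 3 * Suc (psnd (f p n)) < pfst (f p n) * 2 ^ j p n)"
    by (intro computable assms)
  ultimately show ?thesis by (simp only:)
qed

lemma decidable_in_ball_at:
  assumes d: "computable_nat d" and X: "decidable X"
    and "computable_fn m" "computable_fn j" "computable_fn s"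
  shows "decidable (\<lambda>p n. in_ball_at d (X p) (m p n) (j p n) (s p n))"
  unfolding in_ball_at_def component_def
  by (intro decidable_rat_add_less computable computable_fn_computable_nat[OF d] decidable_comp[OF X]
      computable_fn_comp[OF assms(4)] assms(3-))

text \<open>\<open>rat_of_code\<close> divides by the successor of the second entry, so
  \<open>2 ^ k - 1\<close> encodes the radius \<open>(1/2) ^ k\<close>.\<close>

definition small_ball :: "nat \<Rightarrow> nat \<Rightarrow> nat" where
  "small_ball c k = prod_encode (c, prod_encode (1, 2 ^ k - 1))"

lemma rational_ball_small_ball: "rational_ball b (small_ball c k) = ball (b c) ((1/2) ^ k)"
  by (simp add: rational_ball_def small_ball_def rat_of_code_def power_one_over)

lemma computable_fn_small_ball [computable]:
  "computable_fn c \<Longrightarrow> computable_fn k \<Longrightarrow> computable_fn (\<lambda>p n. small_ball (c p n) (k p n))"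
  unfolding small_ball_def by (intro computable)

text \<open>
  Here \<open>p\<close> pairs a name of the function with a name of the argument, the index
  \<open>e\<close> codes \<open>(i, (L, c))\<close>, and \<open>w\<close> codes the witnesses for
  \<open>detects\<close>.
\<close>

definition finds :: "(nat \<Rightarrow> nat) \<Rightarrow> cantor \<Rightarrow> nat \<Rightarrow> nat \<Rightarrow> nat \<Rightarrow> nat \<Rightarrow> bool" where
  "finds d p e c k w \<longleftrightarrow>
     preimage_bit (cfst p) (probe (pfst (psnd e)) (psnd (psnd e)) (small_ball c k)) (pfst e)
       (pfst w) (pfst (psnd w)) \<and>
     in_ball_at d (csnd p) (pfst w) (pfst (psnd (psnd w))) (psnd (psnd (psnd w)))"

lemma decidable_finds:
  assumes d: "computable_nat d"
    and "computable_fn e" "computable_fn c" "computable_fn k" "computable_fn w"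
  shows "decidable (\<lambda>p n. finds d p (e p n) (c p n) (k p n) (w p n))"
  unfolding finds_def
  by (intro decidable_preimage_bit decidable_in_ball_at[OF d] computable
      computable_fn_comp[OF assms(2)] computable_fn_comp[OF assms(3)] computable_fn_comp[OF assms(4)]
      assms(2-))

lemma ex_finds_iff:
  assumes "approximates a d" "cauchy_rep a (csnd p) = Some x"
  shows "(\<exists>w. finds d p e c k w) \<longleftrightarrow>
    detects a (cfst p) x (pfst e) (pfst (psnd e)) (psnd (psnd e)) (small_ball c k)"
proof -
  let ?q = "probe (pfst (psnd e)) (psnd (psnd e)) (small_ball c k)"
  have "(\<exists>w. finds d p e c k w) \<longleftrightarrow>
      (\<exists>m v j s. finds d p e c k (prod_encode (m, prod_encode (v, prod_encode (j, s)))))"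
    by (metis prod_decode_inverse surj_pair)
  also have "\<dots> \<longleftrightarrow> (\<exists>m v. preimage_bit (cfst p) ?q (pfst e) m v \<and> (\<exists>j s. in_ball_at d (csnd p) m j s))"
    by (simp add: finds_def)
  finally show ?thesis
    by (simp add: in_ball_at_iff[OF assms] detects_def)
qed

text \<open>Two balls of radius \<open>(1/2) ^ k\<close> around a common point have centres less
  than \<open>2 * (1/2) ^ k\<close> apart. With the error of \<open>d'\<close> the computed value
  stays below \<open>3 * (1/2) ^ k\<close>, so exceeding it refutes exactness.\<close>

definition conflict :: "(nat \<Rightarrow> nat) \<Rightarrow> (nat \<Rightarrow> nat) \<Rightarrow> cantor \<Rightarrow> nat \<Rightarrow> nat \<Rightarrow> nat \<Rightarrow> nat \<Rightarrow> nat \<Rightarrow> nat \<Rightarrow> bool" where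
  "conflict d d' p e k c w c' w' \<longleftrightarrow> finds d p e c k w \<and> finds d p e c' k w' \<and>
     3 * (1/2) ^ k < rat_of_code (d' (prod_encode (prod_encode (c, c'), k)))"

text \<open>The stage \<open>pfst n\<close> codes all data of a conflict. As a
  \<open>closed_nat_rep\<close> name this describes the set of conflict-free indices.\<close>

definition bad_indices :: "(nat \<Rightarrow> nat) \<Rightarrow> (nat \<Rightarrow> nat) \<Rightarrow> cantor \<Rightarrow> cantor" where
  "bad_indices d d' p n = (let e = psnd n; k = pfst (pfst n); t = psnd (pfst n) in
     conflict d d' p e k (pfst (pfst t)) (psnd (pfst t)) (pfst (psnd t)) (psnd (psnd t)))"

lemma decidable_bad_indices:
  assumes "computable_nat d" "computable_nat d'"
  shows "decidable (bad_indices d d')"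
proof -
  have "decidable (\<lambda>p n. bad_indices d d' p n)"
    unfolding bad_indices_def Let_def conflict_def
    by (intro decidable_less_rat computable decidable_finds[OF assms(1)]
        computable_fn_computable_nat[OF assms(2)])
  then show ?thesis .
qed

lemma enumerated_bad_indices:
  "e \<in> enumerated (bad_indices d d' p) \<longleftrightarrow> (\<exists>k c w c' w'. conflict d d' p e k c w c' w')"
proof
  assume "\<exists>k c w c' w'. conflict d d' p e k c w c' w'"
  then obtain k c w c' w' where "conflict d d' p e k c w c' w'" by blast
  then have "bad_indices d d' p
      (prod_encode (prod_encode (k, prod_encode (prod_encode (c, w), prod_encode (c', w'))), e))"
    by (simp add: bad_indices_def)
  then show "e \<in> enumerated (bad_indices d d' p)" unfolding enumerated_def by blast
next
  assume "e \<in> enumerated (bad_indices d d' p)"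
  then obtain t where "bad_indices d d' p (prod_encode (t, e))"
    by (auto simp: enumerated_def)
  then have "conflict d d' p e (pfst t) (pfst (pfst (psnd t))) (psnd (pfst (psnd t)))
      (pfst (psnd (psnd t))) (psnd (psnd (psnd t)))"
    by (simp add: bad_indices_def Let_def)
  then show "\<exists>k c w c' w'. conflict d d' p e k c w c' w'" by blast
qed

text \<open>
  The radius \<open>(1/2) ^ (k + 3)\<close> compensates the factor \<open>5\<close> in
  \<open>dist_le_if_no_conflict\<close> below.
\<close>

definition approximant :: "(nat \<Rightarrow> nat) \<Rightarrow> cantor \<Rightarrow> nat \<Rightarrow> nat \<Rightarrow> bool" where
  "approximant d r k z \<longleftrightarrow> nat_rep (csnd r) = Some (pfst z) \<and>
     finds d (cfst r) (pfst z) (pfst (psnd z)) (k + 3) (psnd (psnd z))"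

text \<open>The only set bit of component \<open>k\<close> is at the centre of the first approximant
  found, which makes the component a \<open>nat_rep\<close> name of that centre.\<close>

definition limit_name :: "(nat \<Rightarrow> nat) \<Rightarrow> cantor \<rightharpoonup> cantor" where
  "limit_name d r = (if \<forall>k. \<exists>z. approximant d r k z
     then Some (\<lambda>n. psnd n = pfst (psnd (LEAST z. approximant d r (pfst n) z))) else None)"

lemma computable_limit_name:
  assumes "computable_nat d"
  shows "computable_cantor (limit_name d)"
proof -
  have "decidable (\<lambda>r n. finds d (cfst r) (pfst (psnd n)) (pfst (psnd (psnd n))) (pfst (pfst n) + 3)
      (psnd (psnd (psnd n))))"
    \<comment> \<open>The oracle is now the pair \<open>r\<close> of the original input and the
      answer of closed choice; \<open>finds\<close> runs on its first half.\<close>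
    by (intro decidable_subst[OF _ decidable_cfst] decidable_finds[OF assms] computable)
  then have "decidable (\<lambda>r n. approximant d r (pfst (pfst n)) (psnd n))"
    unfolding approximant_def
    by (intro computable decidable_comp[OF decidable_csnd])
  moreover have "computable_fn (\<lambda>r n. of_bool (psnd (pfst n) = pfst (psnd (psnd n))))"
    by (intro computable)
  ultimately have "oracle_recursive (\<lambda>r n. if \<exists>z. approximant d r (pfst n) z
      then Some (of_bool (psnd n = pfst (psnd (LEAST z. approximant d r (pfst n) z)))) else None)"
    by (rule oracle_recursive_search)
  then show ?thesis
    unfolding computable_cantor_def limit_name_def
    by (intro exI conjI) (assumption, auto split: if_splits)
qed

text \<open>
  An index without conflicts need not be exact, but it finds every ball around \<open>y\<close>, so all
  balls it finds are close to \<open>y\<close>.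
\<close>

lemma dist_le_if_no_conflict:
  fixes b :: "nat \<Rightarrow> 'b::metric_space"
  assumes dense: "closure (range b) = UNIV" and d': "approximates b d'"
    and mem: "\<And>c k. y \<in> ball (b c) ((1/2) ^ k) \<Longrightarrow> \<exists>w. finds d p e c k w"
    and nc: "\<And>k c w c' w'. \<not> conflict d d' p e k c w c' w'"
    and c: "finds d p e c k w"
  shows "dist (b c) y \<le> 5 * (1/2) ^ k"
proof -
  have "y \<in> closure (range b)" "(1/2::real) ^ k > 0" using dense by simp_all
  then obtain c' where c': "dist (b c') y < (1/2) ^ k"
    unfolding closure_approachable by blast
  then obtain w' where "finds d p e c' k w'" using mem[of c' k] by auto
  with c nc have "rat_of_code (d' (prod_encode (prod_encode (c, c'), k))) \<le> 3 * (1/2) ^ k"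
    by (meson conflict_def not_less)
  moreover have "\<bar>dist (b c) (b c') - rat_of_code (d' (prod_encode (prod_encode (c, c'), k)))\<bar> \<le> (1/2) ^ k"
    using d' by (simp add: approximates_def)
  \<comment> \<open>The factor 5 is 3 from the absence of conflict, 1 from the error of
    \<open>d'\<close> and 1 from the distance between \<open>b c'\<close> and
    \<open>y\<close>.\<close>
  ultimately show ?thesis
    using c' dist_triangle[of "b c" y "b c'"] by linarith
qed

theorem theorem7:
  fixes a :: "nat \<Rightarrow> 'a::metric_space" and b :: "nat \<Rightarrow> 'b::metric_space"
  assumes "computable_metric_space a" and "computable_metric_space b"
  shows "eval_problem a b \<le>\<^sub>W closed_choice_nat"
proof -
  obtain d d' where d: "computable_nat d" "approximates a d" and d': "computable_nat d'" "approximates b d'"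
    using assms unfolding computable_metric_space_def approximates_def by blast
  have dense: "closure (range b) = UNIV"
    using assms(2) by (simp add: computable_metric_space_def)
  define K :: "cantor \<rightharpoonup> cantor" where "K p = Some (bad_indices d d' p)" for p
  have "computable_cantor K"
    using decidable_bad_indices[OF d(1) d'(1)]
    unfolding computable_cantor_def K_def decidable_def computable_fn_def by auto
  moreover have "realizer (eval_problem a b)
      (\<lambda>p. Option.bind (K p) (\<lambda>k. Option.bind (G k) (\<lambda>r. limit_name d (cpair p r))))"
    if G: "realizer closed_choice_nat G" for G
  proof -
    have "\<exists>q. Option.bind (K p) (\<lambda>k. Option.bind (G k) (\<lambda>r. limit_name d (cpair p r))) = Some q \<and>
        cauchy_rep b q = Some (f x)"
      if f: "delta2_fun_rep a b (cfst p) = Some f" and x: "cauchy_rep a (csnd p) = Some x" for p f x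
    proof -
      have mem: "\<exists>w. finds d p e c k w" if "f x \<in> ball (b c) ((1/2) ^ k)" for e c k
        unfolding ex_finds_iff[OF d(2) x]
        using that by (intro detects_if_mem[OF dense f]) (simp add: rational_ball_small_ball)
      obtain i L c0 where exact: "\<And>m. detects a (cfst p) x i L c0 m \<Longrightarrow> f x \<in> rational_ball b m"
        using ex_exact_index[OF dense f] by blast
      define e0 where "e0 = prod_encode (i, prod_encode (L, c0))"
      have near: "dist (b c) (f x) < (1/2) ^ k" if "finds d p e0 c k w" for c k w
      proof -
        have "detects a (cfst p) x i L c0 (small_ball c k)"
          using ex_finds_iff[OF d(2) x, of e0 c k] that by (auto simp: e0_def)
        from exact[OF this] show ?thesis by (simp add: rational_ball_small_ball)
      qed
      have "\<not> conflict d d' p e0 k c w c' w'" for k c w c' w'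
      proof
        assume "conflict d d' p e0 k c w c' w'"
        then have "dist (b c) (f x) < (1/2) ^ k" "dist (b c') (f x) < (1/2) ^ k"
          "3 * (1/2) ^ k < rat_of_code (d' (prod_encode (prod_encode (c, c'), k)))"
          using near by (auto simp: conflict_def)
        moreover have "\<bar>dist (b c) (b c') - rat_of_code (d' (prod_encode (prod_encode (c, c'), k)))\<bar>
            \<le> (1/2) ^ k"
          using d'(2) by (simp add: approximates_def)
        ultimately show False
          using dist_triangle2[of "b c" "b c'" "f x"] by linarith
      qed
      then have "- enumerated (bad_indices d d' p) \<noteq> {}"
        using enumerated_bad_indices[of e0 d d' p] by blast
      \<comment> \<open>The exact index \<open>e0\<close> only makes the closed set nonempty; the
        answer \<open>e\<close> may be any other conflict-free index.\<close>
      then obtain r e where r: "G (bad_indices d d' p) = Some r" "nat_rep r = Some e"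
        and e: "e \<notin> enumerated (bad_indices d d' p)"
        using G unfolding realizer_def closed_choice_nat_def
        by (simp add: closed_nat_rep_def) blast
      have e: "\<not> conflict d d' p e k c w c' w'" for k c w c' w'
        using e unfolding enumerated_bad_indices by blast
      have approx: "approximant d (cpair p r) k z \<longleftrightarrow>
          pfst z = e \<and> finds d p e (pfst (psnd z)) (k + 3) (psnd (psnd z))" for k z
        by (auto simp: approximant_def r(2))
      have ex: "\<exists>z. approximant d (cpair p r) k z" for k
      proof -
        have "f x \<in> closure (range b)" "(1/2::real) ^ (k + 3) > 0" using dense by simp_all
        then obtain c where "dist (b c) (f x) < (1/2) ^ (k + 3)"
          unfolding closure_approachable by blast
        then obtain w where "finds d p e c (k + 3) w" using mem[of c "k + 3"] by auto
        then have "approximant d (cpair p r) k (prod_encode (e, prod_encode (c, w)))"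
          by (simp add: approx)
        then show ?thesis ..
      qed
      define s where "s k = pfst (psnd (LEAST z. approximant d (cpair p r) k z))" for k
      have s: "dist (b (s k)) (f x) \<le> 5/8 * (1/2) ^ k" for k
      proof -
        have "\<exists>w. finds d p e (s k) (k + 3) w"
          using LeastI_ex[OF ex[of k]] unfolding approx s_def by blast
        then have "dist (b (s k)) (f x) \<le> 5 * (1/2) ^ (k + 3)"
          using dist_le_if_no_conflict[OF dense d'(2) mem e] by blast
        then show ?thesis by (simp add: power_add power3_eq_cube)
      qed
      define q where "q n \<longleftrightarrow> psnd n = s (pfst n)" for n
      have "limit_name d (cpair p r) = Some q"
        using ex by (simp add: limit_name_def q_def[abs_def] s_def)
      moreover have "cauchy_rep b q = Some (f x)"
        unfolding cauchy_rep_eq_Some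
      proof (intro exI[of _ s] conjI allI impI)
        fix k
        have "component q k = (\<lambda>n. n = s k)"
          by (simp add: component_def q_def fun_eq_iff)
        then show "nat_rep (component q k) = Some (s k)"
          by (simp add: nat_rep_def Least_equality)
      next
        fix j k :: nat assume "j < k"
        then have "(1/2::real) ^ k \<le> (1/2) ^ Suc j"
          by (intro power_decreasing) auto
        \<comment> \<open>With \<open>k > j\<close> the two errors add up to at most
          \<open>5/8 * (1 + 1/2) = 15/16\<close> times \<open>(1/2) ^ j\<close>, within the bound of
          a Cauchy name.\<close>
        then have "(1/2::real) ^ k \<le> (1/2) ^ j / 2" "(1/2::real) ^ j > 0"
          by simp_all
        then show "dist (b (s j)) (b (s k)) \<le> (1/2) ^ j"
          using s[of j] s[of k] dist_triangle2[of "b (s j)" "b (s k)" "f x"] by linarith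
      next
        show "(\<lambda>k. b (s k)) \<longlonglongrightarrow> f x"
        proof (rule metric_tendsto_imp_tendsto)
          show "(\<lambda>k. 5/8 * (1/2::real) ^ k) \<longlonglongrightarrow> 0"
            by (intro tendsto_mult_right_zero LIMSEQ_power_zero) simp
          show "\<forall>\<^sub>F k in sequentially. dist (b (s k)) (f x) \<le> dist (5/8 * (1/2::real) ^ k) 0"
            using s by (intro always_eventually allI) simp
        qed
      qed
      ultimately show ?thesis by (simp add: K_def r(1))
    qed
    then show ?thesis
      unfolding realizer_def eval_problem_def
      by (fastforce simp: prod_rep_def bind_eq_Some_conv)
  qed
  ultimately show ?thesis
    unfolding weihrauch_le_def using computable_limit_name[OF d(1)] by blast
qed


end
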